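(* Let $G$ be a discrete group and let $X$ and $Y$ be metric spaces with coarse actions of $G$. If $f\colon X\to Y$ is a coarse $G$-equivalence and $X^G_{bd}$ exists, then $Y^G_{bd}$ exists and it is coarsely equivalent to $X^G_{bd}$.
   Context: A map $f\colon X\to Y$ of metric spaces is an $(L,C)$-quasi-isometry ($L,C>0$) if $\frac1L d_X(x_1,x_2)-C\le d_Y(f(x_1),f(x_2))\le L\,d_X(x_1,x_2)+C$ for all $x_1,x_2\in X$ and every point of $Y$ is within $C$ of $f(X)$. $G$ acts coarsely on $(X,d)$ if there are constants $L,C>0$ and a map $G\times X\to X$, $(g,x)\mapsto gx$, such that each $x\mapsto gx$ is an $(L,C)$-quasi-isometry of $X$, $ex=x$ for all $x$, and $d(g(hx),(gh)x)\le C$ for all $g,h\in G$, $x\in X$. A map $f\colon X\to Y$ between such spaces is coarsely $G$-equivariant if there is $N$ with $d_Y(gf(x),f(gx))\le N$ for all $g\in G$, $x\in X$; a coarse $G$-equivalence is a quasi-isometry which is coarsely $G$-equivariant. A (not necessarily continuous) map is coarse if preimages of bounded sets are bounded and for every $R>0$ there is $S_R>0$ with $d(x_1,x_2)\le R\Rightarrow d(f(x_1),f(x_2))\le S_R$. It is a coarse equivalence if there is a coarse map in the other direction such that both composites are at uniformly bounded distance from the identity maps; two metric spaces are coarsely equivalent if a coarse equivalence between them exists. For $k\ge 0$, $X^G_k=\{x\in X\mid d(x,gx)\le k\ \forall g\in G\}$ with the induced metric. The bounded fixed set exists if there are $k_0>0$ and a subspace $Y_0\subset X^G_{k_0}$ such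 that the inclusion $Y_0\to X^G_k$ is a coarse equivalence for all $k\ge k_0$; then $X^G_{bd}=Y_0$. (If $X^G_k=\emptyset$ for all $k$, then $X^G_{bd}=\emptyset$.) *)

theory Defs
  imports "HOL-Analysis.Analysis" "HOL-Algebra.Group"
begin

text \<open>
  Metric spaces are elements of the type \<open>'a metric\<close>, so a space may be empty and a subspace
  \<open>submetric X S\<close> is again a metric space. A map \<open>X \<rightarrow> Y\<close> is a total function restricted to the
  carriers; its values outside \<open>mspace X\<close> are irrelevant. In particular there is no map from a
  nonempty space to the empty one.
\<close>

definition quasi_isometry_with ::
    "real \<Rightarrow> real \<Rightarrow> 'a metric \<Rightarrow> 'b metric \<Rightarrow> ('a \<Rightarrow> 'b) \<Rightarrow> bool" where
  "quasi_isometry_with L C X Y f \<longleftrightarrow>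
     L > 0 \<and> C > 0 \<and> f \<in> mspace X \<rightarrow> mspace Y \<and>
     (\<forall>x1\<in>mspace X. \<forall>x2\<in>mspace X.
        (1 / L) * mdist X x1 x2 - C \<le> mdist Y (f x1) (f x2) \<and>
        mdist Y (f x1) (f x2) \<le> L * mdist X x1 x2 + C) \<and>
     (\<forall>y\<in>mspace Y. \<exists>x\<in>mspace X. mdist Y y (f x) \<le> C)"

definition quasi_isometry :: "'a metric \<Rightarrow> 'b metric \<Rightarrow> ('a \<Rightarrow> 'b) \<Rightarrow> bool" where
  "quasi_isometry X Y f \<longleftrightarrow> (\<exists>L C. quasi_isometry_with L C X Y f)"

definition coarse_action ::
    "('g, 'm) monoid_scheme \<Rightarrow> 'a metric \<Rightarrow> ('g \<Rightarrow> 'a \<Rightarrow> 'a) \<Rightarrow> bool" where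
  "coarse_action G X act \<longleftrightarrow>
     (\<exists>L C. L > 0 \<and> C > 0 \<and>
        (\<forall>g\<in>carrier G. quasi_isometry_with L C X X (act g)) \<and>
        (\<forall>x\<in>mspace X. act \<one>\<^bsub>G\<^esub> x = x) \<and>
        (\<forall>g\<in>carrier G. \<forall>h\<in>carrier G. \<forall>x\<in>mspace X.
           mdist X (act g (act h x)) (act (g \<otimes>\<^bsub>G\<^esub> h) x) \<le> C))"

definition coarsely_equivariant ::
    "('g, 'm) monoid_scheme \<Rightarrow> 'a metric \<Rightarrow> ('g \<Rightarrow> 'a \<Rightarrow> 'a) \<Rightarrow>
     'b metric \<Rightarrow> ('g \<Rightarrow> 'b \<Rightarrow> 'b) \<Rightarrow> ('a \<Rightarrow> 'b) \<Rightarrow> bool" where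
  "coarsely_equivariant G X actX Y actY f \<longleftrightarrow>
     (\<exists>N. \<forall>g\<in>carrier G. \<forall>x\<in>mspace X. mdist Y (actY g (f x)) (f (actX g x)) \<le> N)"

definition coarse_G_equivalence ::
    "('g, 'm) monoid_scheme \<Rightarrow> 'a metric \<Rightarrow> ('g \<Rightarrow> 'a \<Rightarrow> 'a) \<Rightarrow>
     'b metric \<Rightarrow> ('g \<Rightarrow> 'b \<Rightarrow> 'b) \<Rightarrow> ('a \<Rightarrow> 'b) \<Rightarrow> bool" where
  "coarse_G_equivalence G X actX Y actY f \<longleftrightarrow>
     quasi_isometry X Y f \<and> coarsely_equivariant G X actX Y actY f"

abbreviation bounded_in :: "'a metric \<Rightarrow> 'a set \<Rightarrow> bool" where
  "bounded_in X B \<equiv> Metric_space.mbounded (mspace X) (mdist X) B"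

definition coarse_map :: "'a metric \<Rightarrow> 'b metric \<Rightarrow> ('a \<Rightarrow> 'b) \<Rightarrow> bool" where
  "coarse_map X Y f \<longleftrightarrow>
     f \<in> mspace X \<rightarrow> mspace Y \<and>
     (\<forall>B. bounded_in Y B \<longrightarrow> bounded_in X {x \<in> mspace X. f x \<in> B}) \<and>
     (\<forall>R>0. \<exists>S>0. \<forall>x1\<in>mspace X. \<forall>x2\<in>mspace X.
        mdist X x1 x2 \<le> R \<longrightarrow> mdist Y (f x1) (f x2) \<le> S)"

definition coarse_equivalence :: "'a metric \<Rightarrow> 'b metric \<Rightarrow> ('a \<Rightarrow> 'b) \<Rightarrow> bool" where
  "coarse_equivalence X Y f \<longleftrightarrow>
     coarse_map X Y f \<and>
     (\<exists>h. coarse_map Y X h \<and>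
        (\<exists>K. \<forall>x\<in>mspace X. mdist X (h (f x)) x \<le> K) \<and>
        (\<exists>K. \<forall>y\<in>mspace Y. mdist Y (f (h y)) y \<le> K))"

definition coarsely_equivalent :: "'a metric \<Rightarrow> 'b metric \<Rightarrow> bool" where
  "coarsely_equivalent X Y \<longleftrightarrow> (\<exists>f. coarse_equivalence X Y f)"

definition almost_fixed ::
    "('g, 'm) monoid_scheme \<Rightarrow> 'a metric \<Rightarrow> ('g \<Rightarrow> 'a \<Rightarrow> 'a) \<Rightarrow> real \<Rightarrow> 'a set" where
  "almost_fixed G X act k = {x \<in> mspace X. \<forall>g\<in>carrier G. mdist X x (act g x) \<le> k}"

text \<open>
  The bounded fixed set is only determined up to coarse equivalence, so it is described by a
  predicate on subsets \<open>Y0\<close> of \<open>X\<close>. If \<open>almost_fixed G X act k\<close> is empty for all \<open>k\<close>,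
  the empty set is the unique \<open>Y0\<close> satisfying it.
\<close>

definition is_bounded_fixed_set ::
    "('g, 'm) monoid_scheme \<Rightarrow> 'a metric \<Rightarrow> ('g \<Rightarrow> 'a \<Rightarrow> 'a) \<Rightarrow> 'a set \<Rightarrow> bool" where
  "is_bounded_fixed_set G X act Y0 \<longleftrightarrow>
     (\<exists>k0>0. Y0 \<subseteq> almost_fixed G X act k0 \<and>
        (\<forall>k\<ge>k0. coarse_equivalence (submetric X Y0) (submetric X (almost_fixed G X act k)) id))"

definition bounded_fixed_set_exists ::
    "('g, 'm) monoid_scheme \<Rightarrow> 'a metric \<Rightarrow> ('g \<Rightarrow> 'a \<Rightarrow> 'a) \<Rightarrow> bool" where
  "bounded_fixed_set_exists G X act \<longleftrightarrow> (\<exists>Y0. is_bounded_fixed_set G X act Y0)"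

end

theory Submission
  imports Defs
begin

text \<open>
  An inclusion of subspaces is a coarse equivalence iff it is coarsely dense, that is, iff every
  point of the larger space is at uniformly bounded distance from the smaller one. Hence \<open>X0\<close> is
  a bounded fixed set iff it consists of almost fixed points and is coarsely dense in every set of
  \<open>k\<close>-almost fixed points. A coarse \<open>G\<close>-equivalence \<open>f\<close> maps almost fixed points to
  almost fixed points, and every almost fixed point of \<open>Y\<close> is close to the image of an almost
  fixed point of \<open>X\<close>; so \<open>f ` X0\<close> is a bounded fixed set of \<open>Y\<close>. For any bounded fixed
  set \<open>Y0\<close>, moving the values of \<open>f\<close> on \<open>X0\<close> by a bounded amount into \<open>Y0\<close> gives a
  quasi-isometry from \<open>X0\<close> to \<open>Y0\<close>.
\<close>

section \<open>Quasi-isometries and coarse equivalences\<close>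

lemma mbounded_mspace_iff:
  "bounded_in X B \<longleftrightarrow> B \<subseteq> mspace X \<and> (\<exists>r. \<forall>x\<in>B. \<forall>y\<in>B. mdist X x y \<le> r)"
  using Metric_space.mbounded_alt[OF Metric_space_mspace_mdist[of X]] by blast

lemma mdist_self: "x \<in> mspace X \<Longrightarrow> mdist X x x = 0"
  by simp

lemma mdist_quadrilateral:
  assumes "a \<in> mspace X" "b \<in> mspace X" "c \<in> mspace X" "d \<in> mspace X"
  shows "mdist X a d \<le> mdist X a b + mdist X b c + mdist X c d"
  using mdist_triangle[of a X b d] mdist_triangle[of b X c d] assms by linarith

text \<open>The lower estimate is multiplied out by \<open>L > 0\<close>, so that later steps bound
  distances in \<open>X\<close> by distances in \<open>Y\<close> without division.\<close>

lemma quasi_isometry_withD: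
  assumes "quasi_isometry_with L C X Y f"
  shows "L > 0" "C > 0"
    and "x \<in> mspace X \<Longrightarrow> f x \<in> mspace Y"
    and "x1 \<in> mspace X \<Longrightarrow> x2 \<in> mspace X \<Longrightarrow> mdist X x1 x2 \<le> L * (mdist Y (f x1) (f x2) + C)"
    and "x1 \<in> mspace X \<Longrightarrow> x2 \<in> mspace X \<Longrightarrow> mdist Y (f x1) (f x2) \<le> L * mdist X x1 x2 + C"
    and "y \<in> mspace Y \<Longrightarrow> \<exists>x\<in>mspace X. mdist Y y (f x) \<le> C"
proof -
  show L: "L > 0" and "C > 0"
    using assms by (auto simp: quasi_isometry_with_def)
  show "f x \<in> mspace Y" if "x \<in> mspace X"
    using assms that by (auto simp: quasi_isometry_with_def)
  show "mdist Y (f x1) (f x2) \<le> L * mdist X x1 x2 + C" if "x1 \<in> mspace X" "x2 \<in> mspace X"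
    using assms that by (auto simp: quasi_isometry_with_def)
  show "\<exists>x\<in>mspace X. mdist Y y (f x) \<le> C" if "y \<in> mspace Y"
    using assms that by (auto simp: quasi_isometry_with_def)
  show "mdist X x1 x2 \<le> L * (mdist Y (f x1) (f x2) + C)" if "x1 \<in> mspace X" "x2 \<in> mspace X"
  proof -
    have "(1 / L) * mdist X x1 x2 - C \<le> mdist Y (f x1) (f x2)"
      using assms that by (auto simp: quasi_isometry_with_def)
    then show ?thesis
      using L by (simp add: field_simps)
  qed
qed

lemma quasi_isometry_withI:
  assumes L: "L > 0" and "C > 0"
    and "\<And>x. x \<in> mspace X \<Longrightarrow> f x \<in> mspace Y"
    and lower: "\<And>x1 x2. x1 \<in> mspace X \<Longrightarrow> x2 \<in> mspace X \<Longrightarrow>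
      mdist X x1 x2 \<le> L * (mdist Y (f x1) (f x2) + C)"
    and "\<And>x1 x2. x1 \<in> mspace X \<Longrightarrow> x2 \<in> mspace X \<Longrightarrow>
      mdist Y (f x1) (f x2) \<le> L * mdist X x1 x2 + C"
    and "\<And>y. y \<in> mspace Y \<Longrightarrow> \<exists>x\<in>mspace X. mdist Y y (f x) \<le> C"
  shows "quasi_isometry_with L C X Y f"
proof -
  have "(1 / L) * mdist X x1 x2 - C \<le> mdist Y (f x1) (f x2)"
    if "x1 \<in> mspace X" "x2 \<in> mspace X" for x1 x2
    using lower[OF that] L by (simp add: field_simps)
  then show ?thesis
    using assms by (auto simp: quasi_isometry_with_def)
qed

text \<open>The lower estimate bounds the diameter of the preimage of a bounded set; the upper
  estimate allows \<open>S = L * R + C\<close>.\<close>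

lemma quasi_isometry_imp_coarse_map:
  assumes "quasi_isometry X Y f"
  shows "coarse_map X Y f"
proof -
  obtain L C where qi: "quasi_isometry_with L C X Y f"
    using assms by (auto simp: quasi_isometry_def)
  note f = quasi_isometry_withD[OF qi]
  have "bounded_in X {x \<in> mspace X. f x \<in> B}" if "bounded_in Y B" for B
  proof -
    obtain r where r: "\<forall>x\<in>B. \<forall>y\<in>B. mdist Y x y \<le> r"
      using \<open>bounded_in Y B\<close> by (auto simp: mbounded_mspace_iff)
    have "mdist X x1 x2 \<le> L * (r + C)"
      if "x1 \<in> mspace X" "f x1 \<in> B" "x2 \<in> mspace X" "f x2 \<in> B" for x1 x2
    proof -
      have "L * (mdist Y (f x1) (f x2) + C) \<le> L * (r + C)"
        using r that f(1) by simp
      then show ?thesis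
        using f(4)[OF that(1,3)] by linarith
    qed
    then show ?thesis
      unfolding mbounded_mspace_iff by blast
  qed
  moreover have "\<exists>S>0. \<forall>x1\<in>mspace X. \<forall>x2\<in>mspace X. mdist X x1 x2 \<le> R \<longrightarrow> mdist Y (f x1) (f x2) \<le> S"
    if "R > 0" for R
  proof -
    have "mdist Y (f x1) (f x2) \<le> L * R + C"
      if "x1 \<in> mspace X" "x2 \<in> mspace X" "mdist X x1 x2 \<le> R" for x1 x2
      using f(5)[OF that(1,2)] mult_left_mono[OF that(3), of L] f(1) by linarith
    moreover have "L * R + C > 0"
      using f(1,2) \<open>R > 0\<close> by (simp add: add_pos_pos)
    ultimately show ?thesis
      by blast
  qed
  ultimately show ?thesis
    using f(3) by (auto simp: coarse_map_def)
qed

text \<open>Here \<open>h\<close> is any choice of approximate preimages. Comparing \<open>y\<close>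
  with \<open>f (h y)\<close> turns the estimates for \<open>f\<close> into estimates for
  \<open>h\<close>, and \<open>h (f x)\<close> is close to \<open>x\<close> because \<open>f\<close>
  sends both to nearby points.\<close>

lemma quasi_isometry_coarse_inverse:
  assumes "quasi_isometry_with L C X Y f"
    and h: "\<And>y. y \<in> mspace Y \<Longrightarrow> h y \<in> mspace X"
    and fh: "\<And>y. y \<in> mspace Y \<Longrightarrow> mdist Y (f (h y)) y \<le> C"
  shows "quasi_isometry Y X h"
    and "x \<in> mspace X \<Longrightarrow> mdist X (h (f x)) x \<le> 2 * L * C"
proof -
  note f = quasi_isometry_withD[OF assms(1)]
  show hf: "mdist X (h (f x)) x \<le> 2 * L * C" if "x \<in> mspace X" for x
  proof -
    have "mdist X (h (f x)) x \<le> L * (mdist Y (f (h (f x))) (f x) + C)"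
      using f(3,4) h that by blast
    also have "\<dots> \<le> L * (C + C)"
      using fh[of "f x"] f(1,3) that by (intro mult_left_mono) auto
    finally show ?thesis
      by simp
  qed
  \<comment> \<open>One constant serves three bounds: \<open>3 * L * C\<close> covers the upper
    estimate and the distance \<open>2 * L * C\<close> from \<open>x\<close> to
    \<open>h (f x)\<close>, while \<open>3 * C / L\<close> becomes the error \<open>3 * C\<close> of
    the lower estimate after multiplication by \<open>L\<close>.\<close>
  have "quasi_isometry_with L (3 * L * C + 3 * C / L) Y X h"
  proof (rule quasi_isometry_withI)
    fix y1 y2
    assume y: "y1 \<in> mspace Y" "y2 \<in> mspace Y"
    have mem: "f (h y1) \<in> mspace Y" "f (h y2) \<in> mspace Y"
      using y h f(3) by auto
    have close: "mdist Y y1 (f (h y1)) \<le> C" "mdist Y (f (h y2)) y2 \<le> C"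
      "mdist Y (f (h y1)) y1 \<le> C" "mdist Y y2 (f (h y2)) \<le> C"
      using fh y by (simp_all add: mdist_commute)
    have "mdist Y y1 y2 \<le> L * mdist X (h y1) (h y2) + 3 * C"
      using mdist_quadrilateral[OF y(1) mem y(2)] close f(5)[OF h[OF y(1)] h[OF y(2)]] by linarith
    also have "\<dots> \<le> L * (mdist X (h y1) (h y2) + (3 * L * C + 3 * C / L))"
      using f(1,2) by (simp add: algebra_simps)
    finally show "mdist Y y1 y2 \<le> L * (mdist X (h y1) (h y2) + (3 * L * C + 3 * C / L))" .
    have "mdist X (h y1) (h y2) \<le> L * (mdist Y (f (h y1)) (f (h y2)) + C)"
      using f(4) h y by blast
    also have "\<dots> \<le> L * ((mdist Y y1 y2 + 2 * C) + C)"
      using mdist_quadrilateral[OF mem(1) y mem(2)] close f(1) by (intro mult_left_mono) auto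
    also have "\<dots> \<le> L * mdist Y y1 y2 + (3 * L * C + 3 * C / L)"
      using f(1,2) by (simp add: algebra_simps)
    finally show "mdist X (h y1) (h y2) \<le> L * mdist Y y1 y2 + (3 * L * C + 3 * C / L)" .
  next
    fix x
    assume x: "x \<in> mspace X"
    have "0 \<le> L * C" "0 \<le> C / L"
      using f(1,2) by simp_all
    then have "mdist X x (h (f x)) \<le> 3 * L * C + 3 * C / L"
      using hf[OF x] by (simp add: mdist_commute)
    then show "\<exists>y\<in>mspace Y. mdist X x (h y) \<le> 3 * L * C + 3 * C / L"
      using f(3)[OF x] by blast
  qed (use f(1,2) h in \<open>auto intro: add_pos_pos\<close>)
  then show "quasi_isometry Y X h"
    by (auto simp: quasi_isometry_def)
qed

lemma quasi_isometry_imp_coarse_equivalence: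
  assumes "quasi_isometry X Y f"
  shows "coarse_equivalence X Y f"
proof -
  obtain L C where qi: "quasi_isometry_with L C X Y f"
    using assms by (auto simp: quasi_isometry_def)
  obtain h where h: "\<And>y. y \<in> mspace Y \<Longrightarrow> h y \<in> mspace X"
    and fh: "\<And>y. y \<in> mspace Y \<Longrightarrow> mdist Y (f (h y)) y \<le> C"
    using quasi_isometry_withD(6)[OF qi] by (metis mdist_commute)
  have "coarse_map Y X h" "\<forall>x\<in>mspace X. mdist X (h (f x)) x \<le> 2 * L * C"
    using quasi_isometry_coarse_inverse[OF qi h fh] quasi_isometry_imp_coarse_map by blast+
  then show ?thesis
    using quasi_isometry_imp_coarse_map[OF assms] fh unfolding coarse_equivalence_def by blast
qed

lemma coarsely_equivalent_sym:
  "coarsely_equivalent X Y \<Longrightarrow> coarsely_equivalent Y X"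
  unfolding coarsely_equivalent_def coarse_equivalence_def by blast

section \<open>Coarsely dense subsets\<close>

text \<open>Neither set has to contain the other: images under \<open>f\<close> are compared below
  with sets of almost fixed points of any level.\<close>

definition coarsely_dense :: "'a metric \<Rightarrow> 'a set \<Rightarrow> 'a set \<Rightarrow> bool" where
  "coarsely_dense X A B \<longleftrightarrow> (\<exists>K. \<forall>b\<in>B. \<exists>a\<in>A. mdist X b a \<le> K)"

lemma coarsely_dense_subset: "coarsely_dense X A B \<Longrightarrow> C \<subseteq> B \<Longrightarrow> coarsely_dense X A C"
  unfolding coarsely_dense_def by (meson subsetD)

text \<open>Since \<open>f\<close> need not map \<open>A\<close> into \<open>B\<close>, it is
  replaced on \<open>A\<close> by a map \<open>p\<close> at bounded distance, which only enlarges
  the additive constant.\<close>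

lemma quasi_isometry_submetric:
  assumes qi: "quasi_isometry X Y f"
    and A: "A \<subseteq> mspace X" and B: "B \<subseteq> mspace Y"
    and p: "\<And>a. a \<in> A \<Longrightarrow> p a \<in> B" and close: "\<And>a. a \<in> A \<Longrightarrow> mdist Y (f a) (p a) \<le> K"
    and dense: "coarsely_dense Y (f ` A) B"
  shows "quasi_isometry (submetric X A) (submetric Y B) p"
proof -
  obtain L C where "quasi_isometry_with L C X Y f"
    using qi by (auto simp: quasi_isometry_def)
  note f = quasi_isometry_withD[OF this]
  obtain D where D: "\<And>b. b \<in> B \<Longrightarrow> \<exists>a\<in>A. mdist Y b (f a) \<le> D"
    using dense by (auto simp: coarsely_dense_def)
  \<comment> \<open>The term \<open>2 * \<bar>K\<bar>\<close> pays for moving two endpoints from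
    \<open>f\<close> to \<open>p\<close>, and \<open>\<bar>D\<bar>\<close> for density. The absolute
    values keep \<open>C'\<close> positive, as \<open>K\<close> and \<open>D\<close> may be negative
    when the sets are empty.\<close>
  define C' where "C' = C + 2 * \<bar>K\<bar> + \<bar>D\<bar>"
  have "quasi_isometry_with L C' (submetric X A) (submetric Y B) p"
  proof (rule quasi_isometry_withI)
    fix a1 a2
    assume "a1 \<in> mspace (submetric X A)" "a2 \<in> mspace (submetric X A)"
    then have a: "a1 \<in> A" "a2 \<in> A"
      by auto
    then have mem: "a1 \<in> mspace X" "a2 \<in> mspace X" "f a1 \<in> mspace Y" "f a2 \<in> mspace Y"
      "p a1 \<in> mspace Y" "p a2 \<in> mspace Y"
      using A B p f(3) by auto
    have cl: "mdist Y (f a1) (p a1) \<le> K" "mdist Y (p a1) (f a1) \<le> K"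
      "mdist Y (f a2) (p a2) \<le> K" "mdist Y (p a2) (f a2) \<le> K"
      using close a by (simp_all add: mdist_commute)
    have "mdist Y (f a1) (f a2) \<le> mdist Y (p a1) (p a2) + 2 * K"
      using mdist_quadrilateral[OF mem(3,5,6,4)] cl by linarith
    then have "L * (mdist Y (f a1) (f a2) + C) \<le> L * (mdist Y (p a1) (p a2) + C')"
      using f(1) by (intro mult_left_mono) (auto simp: C'_def)
    then show "mdist (submetric X A) a1 a2 \<le> L * (mdist (submetric Y B) (p a1) (p a2) + C')"
      using f(4)[OF mem(1,2)] by simp
    have "mdist Y (p a1) (p a2) \<le> mdist Y (f a1) (f a2) + 2 * K"
      using mdist_quadrilateral[OF mem(5,3,4,6)] cl by linarith
    then show "mdist (submetric Y B) (p a1) (p a2) \<le> L * mdist (submetric X A) a1 a2 + C'"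
      using f(5)[OF mem(1,2)] by (simp add: C'_def)
  next
    fix b
    assume "b \<in> mspace (submetric Y B)"
    then have b: "b \<in> B"
      by auto
    then obtain a where a: "a \<in> A" "mdist Y b (f a) \<le> D"
      using D by blast
    have "mdist Y b (p a) \<le> mdist Y b (f a) + mdist Y (f a) (p a)"
      using a A B b p f(3) by (intro mdist_triangle) auto
    then have "mdist Y b (p a) \<le> C'"
      using a close[OF a(1)] f(2) by (simp add: C'_def)
    then show "\<exists>a\<in>mspace (submetric X A). mdist (submetric Y B) b (p a) \<le> C'"
      using a A by auto
  qed (use f(1,2) p A B in \<open>auto simp: C'_def\<close>)
  then show ?thesis
    by (auto simp: quasi_isometry_def)
qed

text \<open>A coarse inverse \<open>h\<close> of the inclusion moves points by a bounded amount, so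
  \<open>h b\<close> is a point of \<open>A\<close> near \<open>b\<close>. Conversely, the identity
  of \<open>X\<close> restricts to a quasi-isometry by density.\<close>

lemma inclusion_coarse_equivalence_iff:
  assumes "A \<subseteq> B" "B \<subseteq> mspace X"
  shows "coarse_equivalence (submetric X A) (submetric X B) id \<longleftrightarrow> coarsely_dense X A B"
proof
  assume "coarse_equivalence (submetric X A) (submetric X B) id"
  then obtain h K where h: "h \<in> mspace (submetric X B) \<rightarrow> mspace (submetric X A)"
    and K: "\<forall>b\<in>mspace (submetric X B). mdist (submetric X B) (id (h b)) b \<le> K"
    unfolding coarse_equivalence_def coarse_map_def by blast
  have "h b \<in> A \<and> mdist X b (h b) \<le> K" if "b \<in> B" for b
  proof -
    have "b \<in> mspace (submetric X B)"
      using that assms by auto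
    then show ?thesis
      using h K by (auto simp: mdist_commute)
  qed
  then show "coarsely_dense X A B"
    unfolding coarsely_dense_def by blast
next
  assume dense: "coarsely_dense X A B"
  \<comment> \<open>The identity has no additive error; the second \<open>1\<close> only meets the
    requirement \<open>C > 0\<close>.\<close>
  have "quasi_isometry_with 1 1 X X id"
  proof (rule quasi_isometry_withI)
    show "\<exists>x\<in>mspace X. mdist X y (id x) \<le> 1" if "y \<in> mspace X" for y
      using that by (intro bexI[of _ y]) (auto simp: mdist_self)
  qed auto
  then have "quasi_isometry X X id"
    by (auto simp: quasi_isometry_def)
  then have "quasi_isometry (submetric X A) (submetric X B) id"
    by (rule quasi_isometry_submetric[where K = 0]) (use assms dense in \<open>auto simp: mdist_self\<close>)
  then show "coarse_equivalence (submetric X A) (submetric X B) id"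
    by (rule quasi_isometry_imp_coarse_equivalence)
qed

section \<open>Almost fixed points\<close>

lemma almost_fixed_subset: "almost_fixed G X act k \<subseteq> mspace X"
  by (auto simp: almost_fixed_def)

lemma almost_fixed_mono: "k \<le> l \<Longrightarrow> almost_fixed G X act k \<subseteq> almost_fixed G X act l"
  by (force simp: almost_fixed_def)

text \<open>The threshold \<open>k0\<close> disappears because the sets of almost fixed points
  increase with the level and density passes to smaller sets.\<close>

lemma is_bounded_fixed_set_iff:
  "is_bounded_fixed_set G X act X0 \<longleftrightarrow>
     (\<exists>k. X0 \<subseteq> almost_fixed G X act k) \<and> (\<forall>k. coarsely_dense X X0 (almost_fixed G X act k))"
  (is "?L \<longleftrightarrow> ?R")
proof
  assume ?L
  then obtain k0 where k0: "X0 \<subseteq> almost_fixed G X act k0"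
    and eq: "\<forall>k\<ge>k0. coarse_equivalence (submetric X X0) (submetric X (almost_fixed G X act k)) id"
    by (auto simp: is_bounded_fixed_set_def)
  have "coarsely_dense X X0 (almost_fixed G X act k)" for k
  proof -
    have "X0 \<subseteq> almost_fixed G X act (max k k0)"
      using k0 almost_fixed_mono[of k0 "max k k0"] by (meson max.cobounded2 subset_trans)
    then have "coarsely_dense X X0 (almost_fixed G X act (max k k0))"
      using inclusion_coarse_equivalence_iff[OF _ almost_fixed_subset] eq by (metis max.cobounded2)
    then show ?thesis
      by (rule coarsely_dense_subset) (simp add: almost_fixed_mono)
  qed
  then show ?R
    using k0 by blast
next
  assume ?R
  then obtain k1 where k1: "X0 \<subseteq> almost_fixed G X act k1"
    and dense: "\<And>k. coarsely_dense X X0 (almost_fixed G X act k)"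
    by blast
  \<comment> \<open>The maximum with \<open>1\<close> provides a positive threshold, whatever the
    sign of \<open>k1\<close>.\<close>
  have sub: "X0 \<subseteq> almost_fixed G X act k" if "k \<ge> max k1 1" for k
    using k1 almost_fixed_mono[of k1 k G X act] that by auto
  have "coarse_equivalence (submetric X X0) (submetric X (almost_fixed G X act k)) id"
    if "k \<ge> max k1 1" for k
    using inclusion_coarse_equivalence_iff[OF sub[OF that] almost_fixed_subset] dense by blast
  then show ?L
    unfolding is_bounded_fixed_set_def using sub[OF order_refl]
    by (intro exI[of _ "max k1 1"]) auto
qed

section \<open>Transport of almost fixed points along a coarse \<open>G\<close>-equivalence\<close>

text \<open>The path from \<open>f x\<close> through \<open>f (actX g x)\<close> to
  \<open>actY g (f x)\<close> has length at most \<open>(L * k + C) + N\<close>, uniformly in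
  \<open>g\<close>.\<close>

lemma coarse_G_equivalence_image_almost_fixed:
  assumes actX: "coarse_action G X actX" and f: "coarse_G_equivalence G X actX Y actY f"
    and actY: "coarse_action G Y actY"
  shows "\<exists>l. f ` almost_fixed G X actX k \<subseteq> almost_fixed G Y actY l"
proof -
  obtain L C N where qi: "quasi_isometry_with L C X Y f"
    and N: "\<And>g x. g \<in> carrier G \<Longrightarrow> x \<in> mspace X \<Longrightarrow> mdist Y (actY g (f x)) (f (actX g x)) \<le> N"
    using f unfolding coarse_G_equivalence_def quasi_isometry_def coarsely_equivariant_def by blast
  note f = quasi_isometry_withD[OF qi]
  have "f x \<in> almost_fixed G Y actY (L * k + C + N)" if "x \<in> almost_fixed G X actX k" for x
  proof -
    have x: "x \<in> mspace X"
      using that by (simp add: almost_fixed_def)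
    have "mdist Y (f x) (actY g (f x)) \<le> L * k + C + N" if g: "g \<in> carrier G" for g
    proof -
      have gx: "actX g x \<in> mspace X"
        using actX g x unfolding coarse_action_def by (blast dest: quasi_isometry_withD(3))
      have gfx: "actY g (f x) \<in> mspace Y"
        using actY g f(3)[OF x] unfolding coarse_action_def by (blast dest: quasi_isometry_withD(3))
      have "mdist X x (actX g x) \<le> k"
        using \<open>x \<in> almost_fixed G X actX k\<close> g by (simp add: almost_fixed_def)
      then have "L * mdist X x (actX g x) \<le> L * k"
        using f(1) by simp
      then show ?thesis
        using mdist_triangle[OF f(3)[OF x] f(3)[OF gx] gfx] f(5)[OF x gx] N[OF g x]
        by (simp add: mdist_commute)
    qed
    then show ?thesis
      using f(3)[OF x] by (simp add: almost_fixed_def)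
  qed
  then show ?thesis
    by blast
qed

text \<open>Any approximate preimage \<open>x\<close> of an almost fixed point \<open>y\<close> is
  itself almost fixed: \<open>f x\<close> and \<open>f (actX g x)\<close> are close, and
  \<open>f\<close> reflects closeness.\<close>

lemma coarse_G_equivalence_almost_fixed_dense:
  assumes actX: "coarse_action G X actX" and actY: "coarse_action G Y actY"
    and f: "coarse_G_equivalence G X actX Y actY f"
  shows "\<exists>l. coarsely_dense Y (f ` almost_fixed G X actX l) (almost_fixed G Y actY k)"
proof -
  obtain L C N where qi: "quasi_isometry_with L C X Y f"
    and N: "\<And>g x. g \<in> carrier G \<Longrightarrow> x \<in> mspace X \<Longrightarrow> mdist Y (actY g (f x)) (f (actX g x)) \<le> N"
    using f unfolding coarse_G_equivalence_def quasi_isometry_def coarsely_equivariant_def by blast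
  obtain L' C' where qiY: "\<And>g. g \<in> carrier G \<Longrightarrow> quasi_isometry_with L' C' Y Y (actY g)"
    and L': "L' > 0"
    using actY unfolding coarse_action_def by blast
  note f = quasi_isometry_withD[OF qi]
  \<comment> \<open>This is the length of the chain \<open>f x\<close>, \<open>y\<close>,
    \<open>actY g y\<close>, \<open>actY g (f x)\<close>, \<open>f (actX g x)\<close>. The third
    summand bounds the image under \<open>actY g\<close> of a distance at most \<open>C\<close>; it
    is independent of \<open>g\<close> because \<open>L'\<close> and \<open>C'\<close> are.\<close>
  define m where "m = C + k + (L' * C + C') + N"
  have "\<exists>x\<in>almost_fixed G X actX (L * (m + C)). mdist Y y (f x) \<le> C"
    if y: "y \<in> almost_fixed G Y actY k" for y
  proof -
    have yY: "y \<in> mspace Y"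
      using y by (simp add: almost_fixed_def)
    then obtain x where x: "x \<in> mspace X" and yx: "mdist Y y (f x) \<le> C"
      using f(6) by blast
    have "mdist X x (actX g x) \<le> L * (m + C)" if g: "g \<in> carrier G" for g
    proof -
      have gx: "actX g x \<in> mspace X"
        using actX g x unfolding coarse_action_def by (blast dest: quasi_isometry_withD(3))
      note gY = quasi_isometry_withD[OF qiY[OF g]]
      have "L' * mdist Y y (f x) \<le> L' * C"
        using yx L' by simp
      then have "mdist Y (actY g y) (actY g (f x)) \<le> L' * C + C'"
        using gY(5)[OF yY f(3)[OF x]] by linarith
      moreover have "mdist Y y (actY g y) \<le> k"
        using y g by (simp add: almost_fixed_def)
      moreover have "mdist Y (f x) y \<le> C"
        using yx by (simp add: mdist_commute)
      ultimately have "mdist Y (f x) (actY g (f x)) \<le> C + k + (L' * C + C')"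
        using mdist_quadrilateral[OF f(3)[OF x] yY gY(3)[OF yY] gY(3)[OF f(3)[OF x]]] by linarith
      then have "mdist Y (f x) (f (actX g x)) \<le> m"
        using mdist_triangle[OF f(3)[OF x] gY(3)[OF f(3)[OF x]] f(3)[OF gx]] N[OF g x]
        by (simp add: m_def)
      then have "L * (mdist Y (f x) (f (actX g x)) + C) \<le> L * (m + C)"
        using f(1) by simp
      then show ?thesis
        using f(4)[OF x gx] by linarith
    qed
    then show ?thesis
      using x yx by (auto simp: almost_fixed_def)
  qed
  then show ?thesis
    unfolding coarsely_dense_def by blast
qed

text \<open>Two approximations are composed: \<open>y\<close> is near some \<open>f x\<close> with
  \<open>x\<close> almost fixed, and \<open>x\<close> is near a point \<open>a\<close> of
  \<open>X0\<close>, whence \<open>f x\<close> is near \<open>f a\<close>.\<close>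

lemma coarse_G_equivalence_bounded_fixed_set_dense:
  assumes actX: "coarse_action G X actX" and actY: "coarse_action G Y actY"
    and f: "coarse_G_equivalence G X actX Y actY f"
    and X0: "is_bounded_fixed_set G X actX X0"
  shows "coarsely_dense Y (f ` X0) (almost_fixed G Y actY k)"
proof -
  obtain L C where "quasi_isometry_with L C X Y f"
    using f unfolding coarse_G_equivalence_def quasi_isometry_def by blast
  note f' = quasi_isometry_withD[OF this]
  obtain l D where D: "\<And>y. y \<in> almost_fixed G Y actY k \<Longrightarrow>
      \<exists>x\<in>almost_fixed G X actX l. mdist Y y (f x) \<le> D"
    using coarse_G_equivalence_almost_fixed_dense[OF actX actY f, of k]
    by (auto simp: coarsely_dense_def)
  obtain K where K: "\<And>x. x \<in> almost_fixed G X actX l \<Longrightarrow> \<exists>a\<in>X0. mdist X x a \<le> K"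
    using X0 unfolding is_bounded_fixed_set_iff coarsely_dense_def by meson
  have sub: "X0 \<subseteq> mspace X"
    using X0 almost_fixed_subset unfolding is_bounded_fixed_set_iff by fastforce
  have "\<exists>a\<in>X0. mdist Y y (f a) \<le> D + (L * K + C)" if y: "y \<in> almost_fixed G Y actY k" for y
  proof -
    obtain x where x: "x \<in> almost_fixed G X actX l" "mdist Y y (f x) \<le> D"
      using D y by blast
    obtain a where a: "a \<in> X0" "mdist X x a \<le> K"
      using K x by blast
    have mem: "y \<in> mspace Y" "x \<in> mspace X" "a \<in> mspace X"
      using y x a sub by (auto simp: almost_fixed_def)
    have "L * mdist X x a \<le> L * K"
      using a f'(1) by simp
    then have "mdist Y y (f a) \<le> D + (L * K + C)"
      using mdist_triangle[OF mem(1) f'(3)[OF mem(2)] f'(3)[OF mem(3)]] f'(5)[OF mem(2,3)] x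
      by linarith
    then show ?thesis
      using a by blast
  qed
  then show ?thesis
    unfolding coarsely_dense_def by blast
qed

text \<open>Bounded fixed sets are not unique, so the equivalence is asserted for every choice of
  \<open>X0\<close> and \<open>Y0\<close>.\<close>

theorem proposition4p5:
  fixes G :: "('g, 'm) monoid_scheme"
    and X :: "'a metric" and Y :: "'b metric"
    and actX :: "'g \<Rightarrow> 'a \<Rightarrow> 'a" and actY :: "'g \<Rightarrow> 'b \<Rightarrow> 'b"
    and f :: "'a \<Rightarrow> 'b"
  assumes "group G"
    and "coarse_action G X actX"
    and "coarse_action G Y actY"
    and "coarse_G_equivalence G X actX Y actY f"
    and "bounded_fixed_set_exists G X actX"
  shows "bounded_fixed_set_exists G Y actY \<and>
    (\<forall>X0 Y0. is_bounded_fixed_set G X actX X0 \<longrightarrow> is_bounded_fixed_set G Y actY Y0 \<longrightarrow>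
       coarsely_equivalent (submetric Y Y0) (submetric X X0))"
proof -
  note dense = coarse_G_equivalence_bounded_fixed_set_dense[OF assms(2,3,4)]
  have image: "\<exists>l. f ` X0 \<subseteq> almost_fixed G Y actY l" if "is_bounded_fixed_set G X actX X0" for X0
    using that coarse_G_equivalence_image_almost_fixed[OF assms(2,4,3)]
    unfolding is_bounded_fixed_set_iff by (meson image_mono subset_trans)
  obtain X1 where X1: "is_bounded_fixed_set G X actX X1"
    using assms(5) by (auto simp: bounded_fixed_set_exists_def)
  have "is_bounded_fixed_set G Y actY (f ` X1)"
    unfolding is_bounded_fixed_set_iff using dense[OF X1] image[OF X1] by simp
  then have "bounded_fixed_set_exists G Y actY"
    by (auto simp: bounded_fixed_set_exists_def)
  moreover have "coarsely_equivalent (submetric Y Y0) (submetric X X0)"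
    if X0: "is_bounded_fixed_set G X actX X0" and Y0: "is_bounded_fixed_set G Y actY Y0" for X0 Y0
  proof -
    have sub: "X0 \<subseteq> mspace X" "Y0 \<subseteq> mspace Y"
      using X0 Y0 almost_fixed_subset unfolding is_bounded_fixed_set_iff by fastforce+
    obtain l where l: "f ` X0 \<subseteq> almost_fixed G Y actY l"
      using image[OF X0] by blast
    obtain K where K: "\<And>y. y \<in> almost_fixed G Y actY l \<Longrightarrow> \<exists>b\<in>Y0. mdist Y y b \<le> K"
      using Y0 unfolding is_bounded_fixed_set_iff coarsely_dense_def by blast
    \<comment> \<open>The values of \<open>f\<close> on \<open>X0\<close> lie in one level
      \<open>l\<close> of almost fixed points, so a single \<open>K\<close> bounds their distance to
      \<open>Y0\<close>.\<close>
    then have "\<forall>x\<in>X0. \<exists>b\<in>Y0. mdist Y (f x) b \<le> K"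
      using l by blast
    then obtain p where p: "\<And>x. x \<in> X0 \<Longrightarrow> p x \<in> Y0" "\<And>x. x \<in> X0 \<Longrightarrow> mdist Y (f x) (p x) \<le> K"
      by metis
    \<comment> \<open>The set \<open>Y0\<close> is contained in some level of almost fixed points,
      and the image of \<open>X0\<close> is dense in each level.\<close>
    have "coarsely_dense Y (f ` X0) Y0"
      using coarsely_dense_subset[OF dense[OF X0]] Y0 unfolding is_bounded_fixed_set_iff by blast
    then have "quasi_isometry (submetric X X0) (submetric Y Y0) p"
      using assms(4) quasi_isometry_submetric[OF _ sub p] by (simp add: coarse_G_equivalence_def)
    \<comment> \<open>The map \<open>p\<close> runs from \<open>X0\<close> to \<open>Y0\<close>,
      opposite to the order in the claim; hence the use of symmetry.\<close>
    then show ?thesis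
      using quasi_isometry_imp_coarse_equivalence coarsely_equivalent_sym
      unfolding coarsely_equivalent_def by blast
  qed
  ultimately show ?thesis
    by blast
qed

end
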